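(* Let $N\in\mathbb N$ and $p\ge 0$. Let $h:\mathbb N\to\mathbb R$ be a function with $h(x)=O(x^p)$ as $x\to\infty$, and let $X_1,\dots,X_n$ be independent $\mathbb N$-valued random variables having moments up to order $N+p+1$, with means $\lambda_i=\mathbb E[X_i]>0$. Let $W=X_1+\cdots+X_n$, $\lambda_W=\mathbb E[W]=\lambda_1+\cdots+\lambda_n$, $W^{(i)}=W-X_i$, and for each $i$ let $X_i^*$ be an $\mathbb N$-valued random variable, independent of $W^{(i)}$, having the Poisson $X_i$-zero biased distribution. For a function $g$, let $f_g$ denote the solution of Stein's equation with parameter $\lambda=\lambda_W$ given in the context. Then $$\mathbb E[h(W)]=C_N(h)+e_N(h),$$ where $C_0(h)=\mathcal P_{\lambda_W}(h)$, $e_0(h)=\mathbb E[h(W)]-\mathcal P_{\lambda_W}(h)$, and recursively for $N\ge 1$, $$C_N(h)=C_0(h)+\sum_{i=1}^n\lambda_i\sum_{d\ge 1}(-1)^{d-1}\sum_{\mathbf J\in\mathbb N_*^d,\ |\mathbf J|\le N} m_{X_i}^{(\mathbf J^\circ)}\big(m_{X_i^*}^{(\mathbf J^\dagger)}-m_{X_i}^{(\mathbf J^\dagger)}\big)\,C_{N-|\mathbf J|}\big(\Delta^{|\mathbf J|}f_h(\cdot+1)\big),$$ $$\begin{aligned}e_N(h)=\sum_{i=1}^n\lambda_i\Big[&\sum_{d\ge 1}(-1)^{d-1}\sum_{\mathbf J\in\mathbb N_*^d,\ |\mathbf J|\le N} m_{X_i}^{(\mathbf J^\circ)}\big(m_{X_i^*}^{(\mathbf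 J^\dagger)}-m_{X_i}^{(\mathbf J^\dagger)}\big)\,e_{N-|\mathbf J|}\big(\Delta^{|\mathbf J|}f_h(\cdot+1)\big)\\&+\sum_{k=0}^N m_{X_i^*}^{(k)}\,\varepsilon_{N-k}\big(\Delta^k f_h(\cdot+1),W^{(i)},X_i\big)+\delta_N\big(f_h(\cdot+1),W^{(i)},X_i^*\big)\Big].\end{aligned}$$
   Context: $\mathbb N=\{0,1,2,\dots\}$, $\mathbb N_*=\mathbb N\setminus\{0\}$. $\mathcal P_\lambda(g)$ is the expectation of $g$ under the Poisson distribution with parameter $\lambda$. Stein solution: for $\lambda>0$ and $g:\mathbb N\to\mathbb R$ of polynomial growth, for $x\in\mathbb N_*$, $$f_g(x)=\frac{(x-1)!}{\lambda^x}\sum_{i=x}^\infty\frac{\lambda^i}{i!}\big(g(i)-\mathcal P_\lambda(g)\big);$$ it satisfies $xf_g(x)-\lambda f_g(x+1)=g(x)-\mathcal P_\lambda(g)$. The value $f_g(0)$ is arbitrary and is not used. $f_g(\cdot+1)$ denotes the function $x\mapsto f_g(x+1)$ on $\mathbb N$. Zero bias: for an $\mathbb N$-valued random variable $X$ with mean $\lambda>0$, an $\mathbb N$-valued random variable $X^*$ has the Poisson $X$-zero biased distribution if $\mathbb E[Xf(X)]=\lambda\,\mathbb E[f(X^*+1)]$ for every $f:\mathbb N\to\mathbb R$ such that the left side is well defined; equivalently $\mathbb P(X^*=x)=(x+1)\mathbb P(X=x+1)/\lambda$ for $x\in\mathbb N$. Difference operator: $\Delta f(x)=f(x+1)-f(x)$,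 and $\Delta^k$ is its $k$-th iterate. Moments: for an $\mathbb N$-valued random variable $Y$ with $\mathbb E[Y^k]<\infty$, $m_Y^{(k)}:=\mathbb E\big[\binom{Y}{k}\big]$. Multi-indices: for $d\ge1$ and $\mathbf J=(j_1,\dots,j_d)\in\mathbb N_*^d$, $|\mathbf J|=j_1+\cdots+j_d$ and $m_Y^{(\mathbf J)}=m_Y^{(j_1)}\cdots m_Y^{(j_d)}$; $\mathbf J^\dagger=j_d$ is the last coordinate, and $\mathbf J^\circ=(j_1,\dots,j_{d-1})\in\mathbb N_*^{d-1}$ is $\mathbf J$ with the last coordinate omitted. By convention $\mathbb N_*^0=\{\emptyset\}$, $|\emptyset|=0$, $m_Y^{(\emptyset)}=1$. Remainders: for independent $\mathbb N$-valued random variables $X,Y$ and $M\in\mathbb N$, $$\delta_M(f,X,Y)=\mathbb E\Big[\sum_{0\le j_1<\cdots<j_{M+1}<Y}\Delta^{M+1}f(X+j_1)\Big]$$ (sum over integers $j_1,\dots,j_{M+1}$), and $$\varepsilon_M(f,X,Y)=-\sum_{d\ge0}(-1)^d\sum_{\mathbf J\in\mathbb N_*^d,\ |\mathbf J|\le M}m_Y^{(\mathbf J)}\,\delta_{M-|\mathbf J|}(\Delta^{|\mathbf J|}f,X,Y).$$ *)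

theory Defs
  imports "HOL-Probability.Probability" "HOL-Library.Landau_Symbols"
begin

definition fdiff :: "(nat \<Rightarrow> real) \<Rightarrow> nat \<Rightarrow> real" where
  "fdiff f x = f (x + 1) - f x"

definition poisson_mean :: "real \<Rightarrow> (nat \<Rightarrow> real) \<Rightarrow> real" where
  "poisson_mean l g = measure_pmf.expectation (poisson_pmf l) g"

text \<open>
  Solution of Stein's equation $x f(x) - \lambda f(x+1) = g(x) - P_\lambda(g)$. The series over
  $i \ge x$ is written with $i = x + k$. The formula is meant for $x \ge 1$; the value at 0 is
  irrelevant, since below the solution is used only through its shift, stein_sol_shift.
\<close>
definition stein_sol :: "real \<Rightarrow> (nat \<Rightarrow> real) \<Rightarrow> nat \<Rightarrow> real" where
  "stein_sol l g x =
     fact (x - 1) / l ^ x * (\<Sum>k. l ^ (x + k) / fact (x + k) * (g (x + k) - poisson_mean l g))"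

definition stein_sol_shift :: "real \<Rightarrow> (nat \<Rightarrow> real) \<Rightarrow> nat \<Rightarrow> real" where
  "stein_sol_shift l g x = stein_sol l g (x + 1)"

definition mean :: "'a measure \<Rightarrow> ('a \<Rightarrow> nat) \<Rightarrow> real" where
  "mean M Y = (\<integral>\<omega>. real (Y \<omega>) \<partial>M)"

text \<open>The expectation on the left is well defined when its integrand is integrable.\<close>
definition poisson_zero_biased :: "'a measure \<Rightarrow> ('a \<Rightarrow> nat) \<Rightarrow> ('a \<Rightarrow> nat) \<Rightarrow> bool" where
  "poisson_zero_biased M X Xs \<longleftrightarrow>
     (\<forall>f :: nat \<Rightarrow> real. integrable M (\<lambda>\<omega>. real (X \<omega>) * f (X \<omega>)) \<longrightarrow>
        (\<integral>\<omega>. real (X \<omega>) * f (X \<omega>) \<partial>M) = mean M X * (\<integral>\<omega>. f (Xs \<omega> + 1) \<partial>M))"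

definition binom_moment :: "'a measure \<Rightarrow> ('a \<Rightarrow> nat) \<Rightarrow> nat \<Rightarrow> real" where
  "binom_moment M Y k = (\<integral>\<omega>. real (Y \<omega> choose k) \<partial>M)"

definition binom_moments :: "'a measure \<Rightarrow> ('a \<Rightarrow> nat) \<Rightarrow> nat list \<Rightarrow> real" where
  "binom_moments M Y J = prod_list (map (binom_moment M Y) J)"

text \<open>
  Multi-indices with $d$ positive coordinates and $|J| \le m$, as lists: $|J|$ is sum_list J, and
  for $d \ge 1$ the last coordinate is last J and the multi-index without it is butlast J.
  The set is empty for $d > m$, so sums over all $d$ may be cut off at $d = m$.
\<close>
definition multi_indices :: "nat \<Rightarrow> nat \<Rightarrow> nat list set" where
  "multi_indices d m = {J. length J = d \<and> (\<forall>j\<in>set J. 1 \<le> j) \<and> sum_list J \<le> m}"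

text \<open>Tuples $0 \le j_1 < \dots < j_r < y$.\<close>
definition increasing_tuples :: "nat \<Rightarrow> nat \<Rightarrow> nat list set" where
  "increasing_tuples r y = {js. length js = r \<and> sorted_wrt (<) js \<and> (\<forall>j\<in>set js. j < y)}"

definition taylor_delta ::
  "'a measure \<Rightarrow> nat \<Rightarrow> (nat \<Rightarrow> real) \<Rightarrow> ('a \<Rightarrow> nat) \<Rightarrow> ('a \<Rightarrow> nat) \<Rightarrow> real" where
  "taylor_delta M m f X Y =
     (\<integral>\<omega>. (\<Sum>js\<in>increasing_tuples (m + 1) (Y \<omega>). (fdiff ^^ (m + 1)) f (X \<omega> + hd js)) \<partial>M)"

definition taylor_eps ::
  "'a measure \<Rightarrow> nat \<Rightarrow> (nat \<Rightarrow> real) \<Rightarrow> ('a \<Rightarrow> nat) \<Rightarrow> ('a \<Rightarrow> nat) \<Rightarrow> real" where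
  "taylor_eps M m f X Y =
     - (\<Sum>d = 0..m. (-1) ^ d *
          (\<Sum>J\<in>multi_indices d m.
             binom_moments M Y J * taylor_delta M (m - sum_list J) ((fdiff ^^ sum_list J) f) X Y))"

definition rv_sum :: "nat \<Rightarrow> (nat \<Rightarrow> 'a \<Rightarrow> nat) \<Rightarrow> 'a \<Rightarrow> nat" where
  "rv_sum n X \<omega> = (\<Sum>i = 1..n. X i \<omega>)"

text \<open>The subtraction on natural numbers is exact for $1 \le i \le n$.\<close>
definition rv_sum_without :: "nat \<Rightarrow> (nat \<Rightarrow> 'a \<Rightarrow> nat) \<Rightarrow> nat \<Rightarrow> 'a \<Rightarrow> nat" where
  "rv_sum_without n X i \<omega> = rv_sum n X \<omega> - X i \<omega>"

lemma multi_indices_sum_list_pos: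
  assumes "J \<in> multi_indices d m" "1 \<le> d"
  shows "0 < sum_list J"
  using assms by (cases J) (auto simp: multi_indices_def)

text \<open>
  In the next two functions X i and Xs i stand for $X_i$ and $X_i^*$, for $1 \le i \le n$, all
  defined on the probability space M.
\<close>
function C_term :: "'a measure \<Rightarrow> nat \<Rightarrow> (nat \<Rightarrow> 'a \<Rightarrow> nat) \<Rightarrow> (nat \<Rightarrow> 'a \<Rightarrow> nat) \<Rightarrow>
    nat \<Rightarrow> (nat \<Rightarrow> real) \<Rightarrow> real" where
  "C_term M n X Xs 0 h = poisson_mean (mean M (rv_sum n X)) h"
| "C_term M n X Xs (Suc N) h =
     C_term M n X Xs 0 h +
     (\<Sum>i = 1..n. mean M (X i) *
        (\<Sum>d = 1..Suc N. (-1) ^ (d - 1) *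
           (\<Sum>J\<in>multi_indices d (Suc N).
              binom_moments M (X i) (butlast J) *
              (binom_moment M (Xs i) (last J) - binom_moment M (X i) (last J)) *
              C_term M n X Xs (Suc N - sum_list J)
                ((fdiff ^^ sum_list J) (stein_sol_shift (mean M (rv_sum n X)) h)))))"
  by pat_completeness auto
termination
  by (relation "Wellfounded.measure (\<lambda>(M, n, X, Xs, N, h). N)")
     (auto dest: multi_indices_sum_list_pos)

function e_term :: "'a measure \<Rightarrow> nat \<Rightarrow> (nat \<Rightarrow> 'a \<Rightarrow> nat) \<Rightarrow> (nat \<Rightarrow> 'a \<Rightarrow> nat) \<Rightarrow>
    nat \<Rightarrow> (nat \<Rightarrow> real) \<Rightarrow> real" where
  "e_term M n X Xs 0 h =
     (\<integral>\<omega>. h (rv_sum n X \<omega>) \<partial>M) - poisson_mean (mean M (rv_sum n X)) h"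
| "e_term M n X Xs (Suc N) h =
     (\<Sum>i = 1..n. mean M (X i) *
        ((\<Sum>d = 1..Suc N. (-1) ^ (d - 1) *
            (\<Sum>J\<in>multi_indices d (Suc N).
               binom_moments M (X i) (butlast J) *
               (binom_moment M (Xs i) (last J) - binom_moment M (X i) (last J)) *
               e_term M n X Xs (Suc N - sum_list J)
                 ((fdiff ^^ sum_list J) (stein_sol_shift (mean M (rv_sum n X)) h))))
         + (\<Sum>k = 0..Suc N. binom_moment M (Xs i) k *
              taylor_eps M (Suc N - k)
                ((fdiff ^^ k) (stein_sol_shift (mean M (rv_sum n X)) h))
                (rv_sum_without n X i) (X i))
         + taylor_delta M (Suc N) (stein_sol_shift (mean M (rv_sum n X)) h)
             (rv_sum_without n X i) (Xs i)))"
  by pat_completeness auto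
termination
  by (relation "Wellfounded.measure (\<lambda>(M, n, X, Xs, N, h). N)")
     (auto dest: multi_indices_sum_list_pos)

end

theory Submission
  imports Defs
begin

text \<open>
  With g the shifted Stein solution of h, Stein's equation and the zero-bias identity turn
  E h(W) - P(h) into the sum over i of lambda_i (E g(W_i + X_i*) - E g(W_i + X_i)), where
  W_i = W - X_i. By independence, Newton's expansion in X_i* expresses the first expectation
  through E Delta^k g(W_i), and inverting the Newton expansion in X_i rewrites these through
  E Delta^k g(W), where induction on N applies. The remainders need no estimate of their own:
  pointwise they are the difference of g(W_i + Y) and finitely many products, all integrable
  because g again grows at most like x^p.
\<close>

section \<open>Multi-indices and Newton expansion\<close>

text \<open>Write M_Y(t) for the power series with coefficients \<open>binom_moment M Y k\<close>;
  its constant term is 1. Up to remainders, E g(U + Y) is M_Y(Delta) applied to g, evaluated at U in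
  expectation. Lists of positive integers with sign (-1)^length encode the geometric series for 1 /
  M_Y(t), and isolating the last entry gives the coefficients of M_Ys(t) / M_Y(t) - 1. This is the
  origin of \<open>last\<close> and \<open>butlast\<close> in the recursions. What shapes the
  analytic side is the moment budget. The factor x in the zero-bias identity costs one moment, so
  X_i has order N + p + 1 but its biased version only N + p, which must cover binomials of order up
  to N and functions of growth p. Passing from h to differences of its Stein solution must therefore
  never raise the exponent p, whatever the depth of the recursion.\<close>

definition bounded_multi_indices :: "nat \<Rightarrow> nat list set" where
  "bounded_multi_indices m = {J. (\<forall>j\<in>set J. 1 \<le> j) \<and> sum_list J \<le> m}"

lemma length_le_sum_list: "(\<forall>j\<in>set J. (1::nat) \<le> j) \<Longrightarrow> length J \<le> sum_list J"
  by (induction J) auto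

lemma finite_bounded_multi_indices: "finite (bounded_multi_indices m)"
proof (rule finite_subset)
  show "bounded_multi_indices m \<subseteq> {J. set J \<subseteq> {..m} \<and> length J \<le> m}"
    using length_le_sum_list member_le_sum_list
    by (fastforce simp: bounded_multi_indices_def dest: order_trans)
qed (rule finite_lists_length_le, simp)

text \<open>Entries are at least 1, so a list with sum at most m has length at most m. One finite
  set thus replaces the double sum over d and J, with the sign (-1)^d read off from the
  list.\<close>

lemma bounded_multi_indices_eq_UN:
  "bounded_multi_indices m = (\<Union>d\<in>{0..m}. multi_indices d m)"
  using length_le_sum_list
  by (fastforce simp: bounded_multi_indices_def multi_indices_def dest: order_trans)

lemma finite_multi_indices: "finite (multi_indices d m)"
  by (rule finite_subset[OF _ finite_bounded_multi_indices[of m]])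
     (auto simp: bounded_multi_indices_def multi_indices_def)

lemma sum_multi_indices:
  fixes F :: "nat list \<Rightarrow> real"
  shows "(\<Sum>d = 0..m. (-1) ^ d * (\<Sum>J\<in>multi_indices d m. F J)) =
         (\<Sum>J\<in>bounded_multi_indices m. (-1) ^ length J * F J)"
proof -
  have "(\<Sum>J\<in>bounded_multi_indices m. (-1) ^ length J * F J) =
      (\<Sum>d = 0..m. \<Sum>J\<in>multi_indices d m. (-1) ^ length J * F J)"
    unfolding bounded_multi_indices_eq_UN
    by (rule sum.UNION_disjoint) (auto simp: finite_multi_indices, auto simp: multi_indices_def)
  also have "\<dots> = (\<Sum>d = 0..m. (-1) ^ d * (\<Sum>J\<in>multi_indices d m. F J))"
    by (auto simp: sum_distrib_left multi_indices_def intro!: sum.cong)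
  finally show ?thesis by simp
qed

text \<open>The term d = 0 is the empty list alone, so removing \<open>[]\<close> starts the sum at
  d = 1. Writing the sign as minus (-1)^length keeps the subtraction d - 1 out of later
  computations.\<close>

lemma sum_multi_indices_nonempty:
  fixes F :: "nat list \<Rightarrow> real"
  shows "(\<Sum>d = 1..m. (-1) ^ (d - 1) * (\<Sum>J\<in>multi_indices d m. F J)) =
         (\<Sum>J\<in>bounded_multi_indices m - {[]}. - ((-1) ^ length J) * F J)"
proof -
  have 0: "multi_indices 0 m = {[]}"
    by (auto simp: multi_indices_def)
  have Nil: "[] \<in> bounded_multi_indices m"
    by (simp add: bounded_multi_indices_def)
  have "(\<Sum>d = 1..m. (-1) ^ (d - 1) * (\<Sum>J\<in>multi_indices d m. F J)) =
      - (\<Sum>d = 1..m. (-1) ^ d * (\<Sum>J\<in>multi_indices d m. F J))"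
    unfolding sum_negf[symmetric]
  proof (rule sum.cong)
    fix d assume "d \<in> {1..m}"
    then obtain d' where "d = Suc d'" by (cases d) auto
    then show "(-1) ^ (d - 1) * (\<Sum>J\<in>multi_indices d m. F J) =
        - ((-1) ^ d * (\<Sum>J\<in>multi_indices d m. F J))" by simp
  qed simp
  also have "\<dots> = F [] - (\<Sum>J\<in>bounded_multi_indices m. (-1) ^ length J * F J)"
    unfolding sum_multi_indices[symmetric] by (simp add: sum.atLeast_Suc_atMost[of 0] 0)
  also have "\<dots> = (\<Sum>J\<in>bounded_multi_indices m - {[]}. - ((-1) ^ length J) * F J)"
    by (simp add: sum.remove[OF finite_bounded_multi_indices Nil] sum_negf)
  finally show ?thesis .
qed

text \<open>Choosing J first leaves the degree m - |J| for the last entry: this matches a Newton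
  expansion to order m - |J| of the term with index J.\<close>

lemma sum_multi_indices_snoc:
  fixes F :: "nat list \<Rightarrow> real"
  shows "(\<Sum>J\<in>bounded_multi_indices m - {[]}. F J) =
         (\<Sum>J\<in>bounded_multi_indices m. \<Sum>k = 1..m - sum_list J. F (J @ [k]))"
proof -
  have "(\<Sum>J\<in>bounded_multi_indices m. \<Sum>k = 1..m - sum_list J. F (J @ [k])) =
      (\<Sum>(J, k)\<in>Sigma (bounded_multi_indices m) (\<lambda>J. {1..m - sum_list J}). F (J @ [k]))"
    by (rule sum.Sigma) (auto simp: finite_bounded_multi_indices)
  also have "\<dots> = (\<Sum>J\<in>bounded_multi_indices m - {[]}. F J)"
  proof (rule sum.reindex_bij_witness[where i = "\<lambda>J. (butlast J, last J)" and j = "\<lambda>(J, k). J @ [k]"])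
    fix J assume J: "J \<in> bounded_multi_indices m - {[]}"
    then obtain J' k where "J = J' @ [k]" by (cases J rule: rev_cases) auto
    then show "(butlast J, last J) \<in> Sigma (bounded_multi_indices m) (\<lambda>J. {1..m - sum_list J})"
      using J by (auto simp: bounded_multi_indices_def)
  qed (auto simp: bounded_multi_indices_def)
  finally show ?thesis by simp
qed

text \<open>With the last entry k chosen first, the order is that of an expansion in one variable
  whose k-th term is then expanded inversely in another.\<close>

lemma sum_multi_indices_snoc':
  fixes F :: "nat list \<Rightarrow> real"
  shows "(\<Sum>J\<in>bounded_multi_indices m - {[]}. F J) =
         (\<Sum>k = 1..m. \<Sum>J\<in>bounded_multi_indices (m - k). F (J @ [k]))"
proof -
  have "(\<Sum>k = 1..m. \<Sum>J\<in>bounded_multi_indices (m - k). F (J @ [k])) =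
      (\<Sum>(k, J)\<in>Sigma {1..m} (\<lambda>k. bounded_multi_indices (m - k)). F (J @ [k]))"
    by (rule sum.Sigma) (auto simp: finite_bounded_multi_indices)
  also have "\<dots> = (\<Sum>J\<in>bounded_multi_indices m - {[]}. F J)"
  proof (rule sum.reindex_bij_witness[where i = "\<lambda>J. (last J, butlast J)" and j = "\<lambda>(k, J). J @ [k]"])
    fix J assume J: "J \<in> bounded_multi_indices m - {[]}"
    then obtain J' k where "J = J' @ [k]" by (cases J rule: rev_cases) auto
    then show "(last J, butlast J) \<in> Sigma {1..m} (\<lambda>k. bounded_multi_indices (m - k))"
      using J by (auto simp: bounded_multi_indices_def)
  qed (auto simp: bounded_multi_indices_def)
  finally show ?thesis by simp
qed

section \<open>Increasing tuples and Newton's forward difference formula\<close>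

lemma increasing_tuples_bij:
  "bij_betw set (increasing_tuples r y) {K. K \<subseteq> {..<y} \<and> card K = r}"
proof (rule bij_betwI[where g = sorted_list_of_set])
  show "sorted_list_of_set \<in> {K. K \<subseteq> {..<y} \<and> card K = r} \<rightarrow> increasing_tuples r y"
    by (auto simp: increasing_tuples_def finite_subset[OF _ finite_lessThan])
  show "set \<in> increasing_tuples r y \<rightarrow> {K. K \<subseteq> {..<y} \<and> card K = r}"
    by (auto simp: increasing_tuples_def strict_sorted_iff distinct_card)
qed (auto simp: increasing_tuples_def strict_sorted_iff sorted_list_of_set.idem_if_sorted_distinct
      finite_subset[OF _ finite_lessThan])

lemma card_increasing_tuples: "card (increasing_tuples r y) = y choose r"
  using bij_betw_same_card[OF increasing_tuples_bij] n_subsets[of "{..<y}" r] by simp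

lemma finite_increasing_tuples: "finite (increasing_tuples r y)"
  using bij_betw_finite[OF increasing_tuples_bij]
  by (metis (no_types, lifting) finite_Collect_subsets finite_lessThan finite_subset mem_Collect_eq subsetI)

lemma sum_fdiff: "(\<Sum>j<y. fdiff f (w + j)) = f (w + y) - f w"
  by (induction y) (auto simp: fdiff_def)

text \<open>Prepending a new smallest entry below \<open>hd js\<close> is a bijection, and the
  summand sees only the smallest entry. For r = 0 there would be no head to compare with.\<close>

lemma sum_increasing_tuples_Suc:
  fixes G :: "nat \<Rightarrow> real"
  assumes "1 \<le> r"
  shows "(\<Sum>js\<in>increasing_tuples (Suc r) y. G (hd js)) =
         (\<Sum>js\<in>increasing_tuples r y. \<Sum>j<hd js. G j)"
proof -
  have "(\<Sum>js\<in>increasing_tuples r y. \<Sum>j<hd js. G j) =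
      (\<Sum>(js, j)\<in>Sigma (increasing_tuples r y) (\<lambda>js. {..<hd js}). G j)"
    by (rule sum.Sigma) (auto simp: finite_increasing_tuples)
  also have "\<dots> = (\<Sum>js\<in>increasing_tuples (Suc r) y. G (hd js))"
  proof (rule sum.reindex_bij_witness[where i = "\<lambda>js. (tl js, hd js)" and j = "\<lambda>(js, j). j # js"])
    fix js assume "js \<in> increasing_tuples (Suc r) y"
    then obtain j k ks where "js = j # k # ks"
      using assms by (cases js; cases "tl js") (auto simp: increasing_tuples_def)
    then show "(tl js, hd js) \<in> Sigma (increasing_tuples r y) (\<lambda>js. {..<hd js})"
      using \<open>js \<in> _\<close> by (auto simp: increasing_tuples_def)
  next
    fix a assume "a \<in> Sigma (increasing_tuples r y) (\<lambda>js. {..<hd js})"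
    then obtain js j where a: "a = (js, j)" "js \<in> increasing_tuples r y" "j < hd js" by auto
    then obtain k ks where "js = k # ks"
      using assms by (cases js) (auto simp: increasing_tuples_def)
    then show "(case a of (js, j) \<Rightarrow> j # js) \<in> increasing_tuples (Suc r) y"
      using a by (fastforce simp: increasing_tuples_def)
  qed (auto simp: increasing_tuples_def length_Suc_conv)
  finally show ?thesis by simp
qed

text \<open>The remainder telescopes. With F the difference of order m + 1, F(w + j_1) is F(w) plus
  the sum of Delta F(w + j) over j < j_1. The part F(w) occurs once per tuple, hence binom(y, m + 1)
  times, and the rest is the next remainder.\<close>

lemma newton_expansion:
  "g (w + y) = (\<Sum>k = 0..m. real (y choose k) * (fdiff ^^ k) g w) +
     (\<Sum>js\<in>increasing_tuples (m + 1) y. (fdiff ^^ (m + 1)) g (w + hd js))"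
proof (induction m)
  case 0
  have "increasing_tuples 1 y = (\<lambda>j. [j]) ` {..<y}"
    by (auto simp: increasing_tuples_def length_Suc_conv)
  then have "(\<Sum>js\<in>increasing_tuples 1 y. fdiff g (w + hd js)) = (\<Sum>j<y. fdiff g (w + j))"
    by (simp add: sum.reindex inj_on_def)
  then show ?case by (simp add: sum_fdiff)
next
  case (Suc m)
  let ?F = "(fdiff ^^ (m + 1)) g"
  have "(\<Sum>js\<in>increasing_tuples (Suc (m + 1)) y. fdiff ?F (w + hd js)) =
      (\<Sum>js\<in>increasing_tuples (m + 1) y. \<Sum>j<hd js. fdiff ?F (w + j))"
    by (rule sum_increasing_tuples_Suc) simp
  also have "\<dots> = (\<Sum>js\<in>increasing_tuples (m + 1) y. ?F (w + hd js)) -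
      real (y choose (m + 1)) * ?F w"
    unfolding sum_fdiff by (simp add: sum_subtractf card_increasing_tuples)
  finally show ?case using Suc by simp
qed

section \<open>Polynomial growth and Stein's equation\<close>

text \<open>The base 1 + x is at least 1 and satisfies 1 + x + y \<le> (1 + x)(1 + y). Shifts and
  sums of random variables can thus be bounded without exceptional points, which a big-O statement
  would carry along.\<close>

definition poly_growth :: "real \<Rightarrow> (nat \<Rightarrow> real) \<Rightarrow> bool" where
  "poly_growth p f \<longleftrightarrow> (\<exists>C. \<forall>x. \<bar>f x\<bar> \<le> C * (1 + real x) powr p)"

lemma poly_growthD:
  assumes "poly_growth p f"
  shows "\<exists>C\<ge>0. \<forall>x. \<bar>f x\<bar> \<le> C * (1 + real x) powr p"
proof -
  from assms obtain C where C: "\<And>x. \<bar>f x\<bar> \<le> C * (1 + real x) powr p"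
    by (auto simp: poly_growth_def)
  from C[of 0] have "0 \<le> C" by simp
  with C show ?thesis by blast
qed

lemma poly_growth_bigo:
  assumes "h \<in> O(\<lambda>x. real x powr p)" "0 \<le> p"
  shows "poly_growth p h"
proof -
  from assms(1) obtain c where "0 < c" and "eventually (\<lambda>x. norm (h x) \<le> c * norm (real x powr p)) at_top"
    by (elim landau_o.bigE)
  then obtain x0 where x0: "\<And>x. x0 \<le> x \<Longrightarrow> \<bar>h x\<bar> \<le> c * real x powr p"
    by (auto simp: eventually_at_top_linorder)
  have "\<bar>h x\<bar> \<le> (c + (\<Sum>y<x0. \<bar>h y\<bar>)) * (1 + real x) powr p" for x
  proof (cases "x < x0")
    case True
    have "\<bar>h x\<bar> \<le> (\<Sum>y<x0. \<bar>h y\<bar>)"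
      using True by (intro member_le_sum) auto
    also have "\<dots> \<le> c + (\<Sum>y<x0. \<bar>h y\<bar>)" using \<open>0 < c\<close> by simp
    also have "\<dots> \<le> (c + (\<Sum>y<x0. \<bar>h y\<bar>)) * (1 + real x) powr p"
      using mult_left_mono[of 1 "(1 + real x) powr p" "c + (\<Sum>y<x0. \<bar>h y\<bar>)"] \<open>0 < c\<close> \<open>0 \<le> p\<close>
      by (simp add: ge_one_powr_ge_zero sum_nonneg add_nonneg_nonneg)
    finally show ?thesis .
  next
    case False
    then have "\<bar>h x\<bar> \<le> c * real x powr p" using x0 by simp
    also have "\<dots> \<le> (c + (\<Sum>y<x0. \<bar>h y\<bar>)) * (1 + real x) powr p"
      using \<open>0 < c\<close> \<open>0 \<le> p\<close> by (intro mult_mono powr_mono2) (auto intro!: sum_nonneg add_nonneg_nonneg)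
    finally show ?thesis .
  qed
  then show ?thesis unfolding poly_growth_def by blast
qed

lemma one_plus_powr_add_le:
  assumes "0 \<le> p"
  shows "(1 + real (x + y)) powr p \<le> (1 + real x) powr p * (1 + real y) powr p"
proof -
  have "(1 + real (x + y)) powr p \<le> ((1 + real x) * (1 + real y)) powr p"
    using assms by (intro powr_mono2) (auto simp: algebra_simps)
  then show ?thesis by (simp add: powr_mult)
qed

lemma poly_growth_shift:
  assumes "poly_growth p f" "0 \<le> p"
  shows "poly_growth p (\<lambda>x. f (x + c))"
proof -
  obtain C where C: "0 \<le> C" "\<And>x. \<bar>f x\<bar> \<le> C * (1 + real x) powr p"
    using poly_growthD[OF assms(1)] by blast
  have "\<bar>f (x + c)\<bar> \<le> (C * (1 + real c) powr p) * (1 + real x) powr p" for x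
    using order_trans[OF C(2) mult_left_mono[OF one_plus_powr_add_le[OF assms(2)] C(1)], of x c]
    by (simp add: mult_ac)
  then show ?thesis unfolding poly_growth_def by blast
qed

lemma poly_growth_diff:
  assumes "poly_growth p f" "poly_growth p g"
  shows "poly_growth p (\<lambda>x. f x - g x)"
proof -
  obtain C where C: "0 \<le> C" "\<And>x. \<bar>f x\<bar> \<le> C * (1 + real x) powr p"
    using poly_growthD[OF assms(1)] by blast
  obtain D where D: "0 \<le> D" "\<And>x. \<bar>g x\<bar> \<le> D * (1 + real x) powr p"
    using poly_growthD[OF assms(2)] by blast
  have "\<bar>f x - g x\<bar> \<le> (C + D) * (1 + real x) powr p" for x
    using C(2)[of x] D(2)[of x] by (simp add: algebra_simps)
  then show ?thesis unfolding poly_growth_def by blast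
qed

lemma poly_growth_const:
  assumes "0 \<le> p"
  shows "poly_growth p (\<lambda>_. c)"
proof -
  have "\<bar>c\<bar> \<le> \<bar>c\<bar> * (1 + real x) powr p" for x
    using assms ge_one_powr_ge_zero[of "1 + real x" p] mult_left_mono[of 1 "(1 + real x) powr p" "\<bar>c\<bar>"]
    by simp
  then show ?thesis unfolding poly_growth_def by blast
qed

lemma poly_growth_fdiff_funpow:
  assumes "poly_growth p f" "0 \<le> p"
  shows "poly_growth p ((fdiff ^^ k) f)"
proof (induction k)
  case (Suc k)
  have "fdiff ((fdiff ^^ k) f) = (\<lambda>x. (fdiff ^^ k) f (x + 1) - (fdiff ^^ k) f x)"
    by (auto simp: fdiff_def)
  then show ?case using poly_growth_diff[OF poly_growth_shift[OF Suc assms(2), of 1] Suc] by simp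
qed (simp add: assms)

section \<open>Poisson series and the Stein solution\<close>

lemma summable_exp_powr:
  assumes "0 < l" "0 \<le> p"
  shows "summable (\<lambda>k. l ^ k / fact k * (1 + real k) powr p)"
proof (rule summable_comparison_test')
  show "summable (\<lambda>k. inverse (fact k) * (l * exp p) ^ k)"
    by (rule summable_exp)
  fix k :: nat
  \<comment> \<open>By ln (1 + k) \<le> k the polynomial factor is at most (exp p)^k, so the
    exponential series at l * exp p dominates.\<close>
  have "(1 + real k) powr p \<le> exp (p * real k)"
    using ln_add_one_self_le_self[of "real k"] assms by (simp add: powr_def mult_left_mono)
  also have "\<dots> = exp p ^ k" by (simp add: exp_of_nat2_mult)
  finally show "norm (l ^ k / fact k * (1 + real k) powr p) \<le> inverse (fact k) * (l * exp p) ^ k"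
    using assms by (simp add: power_mult_distrib field_simps)
qed

lemma summable_poisson_poly_growth:
  assumes "0 < l" "0 \<le> p" "poly_growth p u"
  shows "summable (\<lambda>k. \<bar>l ^ k / fact k * u k\<bar>)"
proof -
  obtain C where C: "0 \<le> C" "\<And>x. \<bar>u x\<bar> \<le> C * (1 + real x) powr p"
    using poly_growthD[OF assms(3)] by blast
  show ?thesis
  proof (rule summable_comparison_test')
    show "summable (\<lambda>k. C * (l ^ k / fact k * (1 + real k) powr p))"
      by (intro summable_mult summable_exp_powr assms)
    fix k
    show "norm (\<bar>l ^ k / fact k * u k\<bar>) \<le> C * (l ^ k / fact k * (1 + real k) powr p)"
      using mult_left_mono[OF C(2)[of k], of "l ^ k / fact k"] assms(1)
      by (simp add: abs_mult mult_ac)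
  qed
qed

lemma poisson_mean_sums:
  assumes "0 < l" "0 \<le> p" "poly_growth p g"
  shows "(\<lambda>k. l ^ k / fact k * g k) sums (exp l * poisson_mean l g)"
proof -
  let ?P = "poisson_pmf l"
  have eq: "pmf ?P k * g k = exp (-l) * (l ^ k / fact k * g k)" for k
    using assms by simp
  have summ: "summable (\<lambda>k. \<bar>l ^ k / fact k * g k\<bar>)"
    by (rule summable_poisson_poly_growth) fact+
  have int: "integrable (count_space UNIV) (\<lambda>k. pmf ?P k * g k)"
    unfolding integrable_count_space_nat_iff eq
    using summable_mult[OF summ, of "exp (-l)"] by (simp add: abs_mult)
  have "poisson_mean l g = (\<integral>k. pmf ?P k * g k \<partial>count_space UNIV)"
    unfolding poisson_mean_def measure_pmf_eq_density
    by (subst integral_density) auto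
  then have "(\<lambda>k. exp (-l) * (l ^ k / fact k * g k)) sums poisson_mean l g"
    using sums_integral_count_space_nat[OF int] unfolding eq by simp
  from sums_mult[OF this, of "exp l"] show ?thesis
    by (simp add: mult.assoc[symmetric] exp_minus)
qed

text \<open>Up to its prefactor the solution is a tail of the centred Poisson series, and
  consecutive tails differ by one term. At x = 0 the full series vanishes because g has been
  centred, so the equation holds there whatever the value of the solution at 0.\<close>

lemma stein_equation:
  assumes "0 < l" "0 \<le> p" "poly_growth p g"
  shows "real x * stein_sol l g x - l * stein_sol l g (x + 1) = g x - poisson_mean l g"
proof -
  let ?a = "\<lambda>i. l ^ i / fact i * (g i - poisson_mean l g)"
  let ?S = "\<lambda>x. \<Sum>k. ?a (x + k)"
  have "poly_growth p (\<lambda>i. g i - poisson_mean l g)"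
    by (intro poly_growth_diff poly_growth_const assms)
  then have summ: "summable ?a"
    by (intro summable_rabs_cancel[OF summable_poisson_poly_growth[OF assms(1,2)]])
  have S_Suc: "?S x = ?a x + ?S (x + 1)"
  proof -
    have "summable (\<lambda>k. ?a (x + k))"
      using summable_ignore_initial_segment[OF summ, of x] by (simp add: add.commute)
    from suminf_split_head[OF this] show ?thesis by simp
  qed
  have S0: "?S 0 = 0"
  proof -
    have "(\<lambda>k. l ^ k / fact k) sums exp l"
      using exp_converges[of l] by (simp add: divide_inverse mult.commute)
    from sums_diff[OF poisson_mean_sums[OF assms] sums_mult2[OF this, of "poisson_mean l g"]]
    have "?a sums 0" by (simp add: right_diff_distrib diff_divide_distrib mult_ac)
    then show ?thesis by (simp add: sums_iff)
  qed
  have sol: "stein_sol l g y = fact (y - 1) / l ^ y * ?S y" for y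
    by (simp add: stein_sol_def)
  have "real x * stein_sol l g x = fact x / l ^ x * ?S x"
  proof (cases x)
    case 0
    then show ?thesis using S0 by simp
  next
    case (Suc y)
    then show ?thesis unfolding sol by simp
  qed
  moreover have "l * stein_sol l g (x + 1) = fact x / l ^ x * ?S (x + 1)"
    using assms(1) unfolding sol by simp
  ultimately have "real x * stein_sol l g x - l * stein_sol l g (x + 1) = fact x / l ^ x * ?a x"
    unfolding S_Suc by (simp add: algebra_simps)
  then show ?thesis using assms(1) by simp
qed

text \<open>By x! k! \<le> (x + 1 + k)! the prefactor x! / l^(x+1) reduces the weight of the k-th
  term to at most l^k / k!, free of x. Submultiplicativity then pulls (1 + x) powr p out of the
  series, with the exponent p unchanged.\<close>

lemma poly_growth_stein_sol_shift:
  assumes "0 < l" "0 \<le> p" "poly_growth p g"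
  shows "poly_growth p (stein_sol_shift l g)"
proof -
  define u where "u i = g i - poisson_mean l g" for i
  have "poly_growth p u"
    unfolding u_def by (intro poly_growth_diff poly_growth_const assms)
  then obtain C where C: "0 \<le> C" "\<And>x. \<bar>u x\<bar> \<le> C * (1 + real x) powr p"
    using poly_growthD by blast
  define b where "b k = l ^ k / fact k * (1 + real k) powr p" for k
  have summ_b: "summable b"
    unfolding b_def using assms by (intro summable_exp_powr)
  have "\<bar>stein_sol_shift l g x\<bar> \<le> (C * 2 powr p * suminf b) * (1 + real x) powr p" for x
  proof -
    define D where "D = C * 2 powr p * (1 + real x) powr p"
    define c where "c = fact x / l ^ (x + 1)"
    define a where "a k = l ^ (x + 1 + k) / fact (x + 1 + k) * u (x + 1 + k)" for k
    have "0 < c" using assms(1) by (simp add: c_def)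
    have bound: "norm (c * a k) \<le> D * b k" for k
    proof -
      have "fact x * fact k dvd (fact (x + k) :: nat)" by (rule fact_fact_dvd_fact)
      then have "fact x * fact k \<le> (fact (x + k) :: nat)" by (rule dvd_imp_le) simp
      also have "\<dots> \<le> fact (x + 1 + k)" by (rule fact_mono) simp
      finally have "real (fact x * fact k) \<le> real (fact (x + 1 + k))" by (rule of_nat_mono)
      then have fact_le: "fact x / fact (x + 1 + k) \<le> (1 / fact k :: real)"
        by (simp add: divide_simps del: fact_Suc)
      have powr_le: "\<bar>u (x + 1 + k)\<bar> \<le> D * (1 + real k) powr p"
      proof -
        \<comment> \<open>The 2 pays for the shift by one: 1 + (x + 1 + k) \<le> 2 (1 + x)(1 +
          k).\<close>
        have "(1 + real (x + 1 + k)) powr p \<le> (2 * (1 + real x) * (1 + real k)) powr p"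
          using assms by (intro powr_mono2) (auto simp: algebra_simps)
        also have "\<dots> = 2 powr p * (1 + real x) powr p * (1 + real k) powr p"
          by (simp only: powr_mult)
        finally have "C * (1 + real (x + 1 + k)) powr p \<le> D * (1 + real k) powr p"
          unfolding D_def mult.assoc using C(1) by (rule mult_left_mono)
        then show ?thesis using C(2)[of "x + 1 + k"] by linarith
      qed
      have "norm (c * a k) = l ^ k * (fact x / fact (x + 1 + k)) * \<bar>u (x + 1 + k)\<bar>"
        using assms(1) unfolding c_def a_def
        by (simp add: abs_mult power_add field_simps del: fact_Suc)
      also have "\<dots> \<le> l ^ k * (1 / fact k) * (D * (1 + real k) powr p)"
        using assms(1) fact_le powr_le by (intro mult_mono) auto
      finally show ?thesis by (simp add: b_def mult_ac)
    qed
    have "stein_sol_shift l g x = c * suminf a"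
      unfolding stein_sol_shift_def stein_sol_def a_def u_def c_def by simp
    also have "\<dots> = (\<Sum>k. c * a k)"
    proof (rule suminf_mult[symmetric])
      have "summable (\<lambda>k. c * a k)"
        by (rule summable_comparison_test'[OF summable_mult[OF summ_b, of D] bound])
      then show "summable a" using \<open>0 < c\<close> by (simp add: summable_cmult_iff)
    qed
    finally have "\<bar>stein_sol_shift l g x\<bar> = norm (\<Sum>k. c * a k)" by simp
    also have "\<dots> \<le> (\<Sum>k. D * b k)"
      by (rule norm_suminf_le[OF bound summable_mult[OF summ_b]])
    also have "\<dots> = D * suminf b" by (rule suminf_mult[OF summ_b])
    finally show ?thesis by (simp add: D_def mult_ac)
  qed
  then show ?thesis unfolding poly_growth_def by blast
qed

section \<open>Independence, zero bias and inverse Taylor expansion\<close>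

context prob_space
begin

lemma borel_measurable_nat_rv:
  fixes F :: "nat \<Rightarrow> real"
  assumes "U \<in> measurable M (count_space UNIV)"
  shows "(\<lambda>\<omega>. F (U \<omega>)) \<in> borel_measurable M"
  by (rule measurable_compose[OF assms]) simp

lemma borel_measurable_nat_rv2:
  fixes F :: "nat \<Rightarrow> nat \<Rightarrow> real"
  assumes "U \<in> measurable M (count_space UNIV)" "V \<in> measurable M (count_space UNIV)"
  shows "(\<lambda>\<omega>. F (U \<omega>) (V \<omega>)) \<in> borel_measurable M"
  by (rule measurable_compose_countable[OF borel_measurable_nat_rv[OF assms(2)] assms(1)])

text \<open>This is Fubini for the joint law, which independence makes a product. It serves to
  freeze U and apply the zero-bias identity to the inner integral over V alone.\<close>

lemma indep_nat_expectation_iterated: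
  fixes F :: "nat \<Rightarrow> nat \<Rightarrow> real"
  assumes indep: "indep_var (count_space UNIV) U (count_space UNIV) V"
    and int: "integrable M (\<lambda>\<omega>. F (U \<omega>) (V \<omega>))"
  shows "(\<integral>\<omega>. F (U \<omega>) (V \<omega>) \<partial>M) = (\<integral>\<omega>. (\<integral>\<omega>'. F (U \<omega>) (V \<omega>') \<partial>M) \<partial>M)"
proof -
  let ?N = "count_space UNIV :: nat measure"
  have U[measurable]: "U \<in> measurable M ?N" and V[measurable]: "V \<in> measurable M ?N"
    using indep_var_rv1[OF indep] indep_var_rv2[OF indep] .
  have eq: "distr M ?N U \<Otimes>\<^sub>M distr M ?N V = distr M (?N \<Otimes>\<^sub>M ?N) (\<lambda>\<omega>. (U \<omega>, V \<omega>))"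
    using indep unfolding indep_var_distribution_eq by blast
  interpret DU: prob_space "distr M ?N U" by (rule prob_space_distr) fact
  interpret DV: prob_space "distr M ?N V" by (rule prob_space_distr) fact
  interpret P: pair_prob_space "distr M ?N U" "distr M ?N V" ..
  have F[measurable]: "(\<lambda>x. F (fst x) (snd x)) \<in> borel_measurable (?N \<Otimes>\<^sub>M ?N)"
    by (simp add: pair_measure_countable)
  have "integrable (distr M (?N \<Otimes>\<^sub>M ?N) (\<lambda>\<omega>. (U \<omega>, V \<omega>))) (\<lambda>x. F (fst x) (snd x))"
    using int by (subst integrable_distr_eq) auto
  from P.integral_fst'[OF this[folded eq]]
  have "(\<integral>\<omega>. F (U \<omega>) (V \<omega>) \<partial>M) = (\<integral>x. (\<integral>y. F x y \<partial>distr M ?N V) \<partial>distr M ?N U)"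
    unfolding eq by (simp add: integral_distr)
  also have "\<dots> = (\<integral>\<omega>. (\<integral>\<omega>'. F (U \<omega>) (V \<omega>') \<partial>M) \<partial>M)"
    by (simp add: integral_distr)
  finally show ?thesis .
qed

lemma indep_nat_mult:
  fixes f g :: "nat \<Rightarrow> real"
  assumes indep: "indep_var (count_space UNIV) U (count_space UNIV) V"
    and "integrable M (\<lambda>\<omega>. f (U \<omega>))" "integrable M (\<lambda>\<omega>. g (V \<omega>))"
  shows "integrable M (\<lambda>\<omega>. f (U \<omega>) * g (V \<omega>))"
    and "(\<integral>\<omega>. f (U \<omega>) * g (V \<omega>) \<partial>M) = (\<integral>\<omega>. f (U \<omega>) \<partial>M) * (\<integral>\<omega>. g (V \<omega>) \<partial>M)"
proof -
  have "indep_var borel (f \<circ> U) borel (g \<circ> V)"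
    by (rule indep_var_compose[OF indep]) auto
  then have "indep_var borel (\<lambda>\<omega>. f (U \<omega>)) borel (\<lambda>\<omega>. g (V \<omega>))"
    by (simp add: comp_def)
  from indep_var_integrable[OF this assms(2,3)] indep_var_lebesgue_integral[OF this assms(2,3)]
  show "integrable M (\<lambda>\<omega>. f (U \<omega>) * g (V \<omega>))"
    and "(\<integral>\<omega>. f (U \<omega>) * g (V \<omega>) \<partial>M) = (\<integral>\<omega>. f (U \<omega>) \<partial>M) * (\<integral>\<omega>. g (V \<omega>) \<partial>M)" .
qed

lemma indep_var_nat_commute:
  assumes "indep_var (count_space UNIV) U (count_space UNIV) (V :: 'a \<Rightarrow> nat)"
  shows "indep_var (count_space UNIV) V (count_space UNIV) (U :: 'a \<Rightarrow> nat)"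
  using assms unfolding indep_var_eq indep_sets2_eq
  by (metis (no_types, lifting) inf_commute mult.commute)

text \<open>Truncating f makes both sides of the zero-bias identity bounded, so that integrability
  on the left, which is all that is known at first, passes to the right by monotone convergence.\<close>
lemma zero_biased_integrable:
  fixes f :: "nat \<Rightarrow> real"
  assumes zb: "poisson_zero_biased M X Xs" and pos: "0 < mean M X"
    and X: "X \<in> measurable M (count_space UNIV)" and Xs: "Xs \<in> measurable M (count_space UNIV)"
    and int: "integrable M (\<lambda>\<omega>. real (X \<omega>) * f (X \<omega>))"
  shows "integrable M (\<lambda>\<omega>. f (Xs \<omega> + 1))"
proof -
  define t where "t m x = (if x \<le> m then \<bar>f x\<bar> else 0)" for m x :: nat
  have t_le: "\<bar>t m x\<bar> \<le> \<bar>f x\<bar>" for m x by (simp add: t_def)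
  have t_lim: "(\<lambda>m. t m x) \<longlonglongrightarrow> \<bar>f x\<bar>" for x
    by (rule tendsto_eventually) (auto simp: t_def eventually_sequentially)
  have int_t: "integrable M (\<lambda>\<omega>. real (X \<omega>) * t m (X \<omega>))" for m
    by (rule Bochner_Integration.integrable_bound[OF int])
       (auto simp: abs_mult t_le mult_left_mono intro!: borel_measurable_nat_rv[OF X])
  have zb_t: "(\<integral>\<omega>. t m (Xs \<omega> + 1) \<partial>M) = (\<integral>\<omega>. real (X \<omega>) * t m (X \<omega>) \<partial>M) / mean M X" for m
    using zb int_t[of m] pos by (simp add: poisson_zero_biased_def)
  have "integrable M (\<lambda>\<omega>. \<bar>f (Xs \<omega> + 1)\<bar>)"
  proof (rule integrable_monotone_convergence)
    fix m
    \<comment> \<open>A function supported on x \<le> m has finitely many nonzero values, and their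
      absolute values sum to a bound.\<close>
    have "\<bar>t m x\<bar> \<le> (\<Sum>y\<le>m. \<bar>f y\<bar>)" for x
      by (auto simp: t_def intro!: member_le_sum sum_nonneg)
    then show "integrable M (\<lambda>\<omega>. t m (Xs \<omega> + 1))"
      by (intro integrable_const_bound[where B = "\<Sum>y\<le>m. \<bar>f y\<bar>"] borel_measurable_nat_rv[OF Xs]) auto
  next
    show "AE \<omega> in M. mono (\<lambda>m. t m (Xs \<omega> + 1))"
      by (auto simp: t_def mono_def)
    show "AE \<omega> in M. (\<lambda>m. t m (Xs \<omega> + 1)) \<longlonglongrightarrow> \<bar>f (Xs \<omega> + 1)\<bar>"
      using t_lim by simp
    have "(\<lambda>m. \<integral>\<omega>. real (X \<omega>) * t m (X \<omega>) \<partial>M) \<longlonglongrightarrow> (\<integral>\<omega>. real (X \<omega>) * \<bar>f (X \<omega>)\<bar> \<partial>M)"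
    proof (rule integral_dominated_convergence)
      show "integrable M (\<lambda>\<omega>. \<bar>real (X \<omega>) * f (X \<omega>)\<bar>)" using int by simp
      show "AE \<omega> in M. (\<lambda>m. real (X \<omega>) * t m (X \<omega>)) \<longlonglongrightarrow> real (X \<omega>) * \<bar>f (X \<omega>)\<bar>"
        by (intro AE_I2 tendsto_mult tendsto_const t_lim)
    qed (auto simp: abs_mult t_le mult_left_mono intro!: borel_measurable_nat_rv[OF X])
    then show "(\<lambda>m. \<integral>\<omega>. t m (Xs \<omega> + 1) \<partial>M) \<longlonglongrightarrow>
        (\<integral>\<omega>. real (X \<omega>) * \<bar>f (X \<omega>)\<bar> \<partial>M) / mean M X"
      unfolding zb_t using pos by (intro tendsto_divide tendsto_const) auto
    show "(\<lambda>\<omega>. \<bar>f (Xs \<omega> + 1)\<bar>) \<in> borel_measurable M"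
      by (rule borel_measurable_nat_rv[OF Xs])
  qed
  then show ?thesis
    by (subst (asm) integrable_abs_iff) (rule borel_measurable_nat_rv[OF Xs])
qed

section \<open>Newton expansions of expectations and their inversion\<close>

lemma expectation_newton_expansion:
  assumes "integrable M (\<lambda>\<omega>. g (U \<omega> + Y \<omega>))"
    and "\<And>k. k \<le> m \<Longrightarrow> integrable M (\<lambda>\<omega>. real (Y \<omega> choose k) * (fdiff ^^ k) g (U \<omega>))"
  shows "(\<integral>\<omega>. g (U \<omega> + Y \<omega>) \<partial>M) =
     (\<Sum>k = 0..m. (\<integral>\<omega>. real (Y \<omega> choose k) * (fdiff ^^ k) g (U \<omega>) \<partial>M)) + taylor_delta M m g U Y"
proof -
  have "taylor_delta M m g U Y =
      (\<integral>\<omega>. g (U \<omega> + Y \<omega>) - (\<Sum>k = 0..m. real (Y \<omega> choose k) * (fdiff ^^ k) g (U \<omega>)) \<partial>M)"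
    unfolding taylor_delta_def by (subst newton_expansion[of g _ _ m]) simp
  also have "\<dots> = (\<integral>\<omega>. g (U \<omega> + Y \<omega>) \<partial>M) -
      (\<Sum>k = 0..m. (\<integral>\<omega>. real (Y \<omega> choose k) * (fdiff ^^ k) g (U \<omega>) \<partial>M))"
    using assms by (subst Bochner_Integration.integral_diff) (auto simp: Bochner_Integration.integral_sum)
  finally show ?thesis by simp
qed

lemma taylor_expansion_indep:
  assumes "indep_var (count_space UNIV) Y (count_space UNIV) U"
    and "integrable M (\<lambda>\<omega>. g (U \<omega> + Y \<omega>))"
    and "\<And>k. k \<le> m \<Longrightarrow> integrable M (\<lambda>\<omega>. real (Y \<omega> choose k))"
    and "\<And>k. k \<le> m \<Longrightarrow> integrable M (\<lambda>\<omega>. (fdiff ^^ k) g (U \<omega>))"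
  shows "(\<integral>\<omega>. g (U \<omega> + Y \<omega>) \<partial>M) =
     (\<Sum>k = 0..m. binom_moment M Y k * (\<integral>\<omega>. (fdiff ^^ k) g (U \<omega>) \<partial>M)) + taylor_delta M m g U Y"
proof -
  note * = indep_nat_mult[OF assms(1), where f = "\<lambda>y. real (y choose k)" for k, OF assms(3) assms(4)]
  show ?thesis
    by (subst expectation_newton_expansion[where m = m])
       (auto simp: assms(2) binom_moment_def * intro!: sum.cong)
qed

lemma taylor_eps_eq:
  "taylor_eps M m f U Y = - (\<Sum>J\<in>bounded_multi_indices m. (-1) ^ length J *
     (binom_moments M Y J * taylor_delta M (m - sum_list J) ((fdiff ^^ sum_list J) f) U Y))"
  unfolding taylor_eps_def sum_multi_indices ..

text \<open>Expanding every expectation on the right at U, the terms cancel in pairs: the term with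
  outer index J and Newton index k belongs to J extended by k, which has opposite sign.\<close>
lemma reverse_taylor_expansion:
  assumes indep: "indep_var (count_space UNIV) Y (count_space UNIV) U"
    and int: "\<And>k. k \<le> m \<Longrightarrow> integrable M (\<lambda>\<omega>. (fdiff ^^ k) g (U \<omega> + Y \<omega>))"
    and choose: "\<And>k. k \<le> m \<Longrightarrow> integrable M (\<lambda>\<omega>. real (Y \<omega> choose k))"
    and int': "\<And>k. k \<le> m \<Longrightarrow> integrable M (\<lambda>\<omega>. (fdiff ^^ k) g (U \<omega>))"
  shows "(\<integral>\<omega>. g (U \<omega>) \<partial>M) =
     (\<Sum>J\<in>bounded_multi_indices m. (-1) ^ length J *
        (binom_moments M Y J * (\<integral>\<omega>. (fdiff ^^ sum_list J) g (U \<omega> + Y \<omega>) \<partial>M)))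
     + taylor_eps M m g U Y"
proof -
  let ?B = "bounded_multi_indices m"
  define A where "A k = (\<integral>\<omega>. (fdiff ^^ k) g (U \<omega>) \<partial>M)" for k
  define G where "G J = (-1) ^ length J * (binom_moments M Y J * A (sum_list J))" for J
  have Nil: "[] \<in> ?B" by (simp add: bounded_multi_indices_def)
  have step: "(-1) ^ length J * (binom_moments M Y J *
        ((\<integral>\<omega>. (fdiff ^^ sum_list J) g (U \<omega> + Y \<omega>) \<partial>M)
         - taylor_delta M (m - sum_list J) ((fdiff ^^ sum_list J) g) U Y)) =
      G J - (\<Sum>k = 1..m - sum_list J. G (J @ [k]))" if "J \<in> ?B" for J
  proof -
    have le: "sum_list J \<le> m" using that by (simp add: bounded_multi_indices_def)
    have funpow: "(fdiff ^^ k) ((fdiff ^^ sum_list J) g) = (fdiff ^^ (sum_list J + k)) g" for k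
      by (metis add.commute comp_apply funpow_add)
    have "(\<integral>\<omega>. (fdiff ^^ sum_list J) g (U \<omega> + Y \<omega>) \<partial>M)
         - taylor_delta M (m - sum_list J) ((fdiff ^^ sum_list J) g) U Y =
         (\<Sum>k = 0..m - sum_list J. binom_moment M Y k * A (sum_list J + k))"
      using le int choose int'
      by (subst taylor_expansion_indep[OF indep, where m = "m - sum_list J"]) (auto simp: funpow A_def)
    \<comment> \<open>The moment of order 0 is 1, so k = 0 keeps the list and gives
      \<open>G J\<close>; every k \<ge> 1 lengthens it by one entry.\<close>
    also have "\<dots> = A (sum_list J) + (\<Sum>k = 1..m - sum_list J. binom_moment M Y k * A (sum_list J + k))"
      by (simp add: sum.atLeast_Suc_atMost[of 0] binom_moment_def prob_space)
    finally show ?thesis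
      by (simp add: G_def binom_moments_def sum_distrib_left sum_negf algebra_simps)
  qed
  have "(\<Sum>J\<in>?B. (-1) ^ length J *
        (binom_moments M Y J * (\<integral>\<omega>. (fdiff ^^ sum_list J) g (U \<omega> + Y \<omega>) \<partial>M)))
     + taylor_eps M m g U Y =
     (\<Sum>J\<in>?B. (-1) ^ length J * (binom_moments M Y J *
        ((\<integral>\<omega>. (fdiff ^^ sum_list J) g (U \<omega> + Y \<omega>) \<partial>M)
         - taylor_delta M (m - sum_list J) ((fdiff ^^ sum_list J) g) U Y)))"
    unfolding taylor_eps_eq by (simp add: right_diff_distrib sum_subtractf)
  also have "\<dots> = (\<Sum>J\<in>?B. G J - (\<Sum>k = 1..m - sum_list J. G (J @ [k])))"
    by (intro sum.cong refl step)
  also have "\<dots> = (\<Sum>J\<in>?B. G J) - (\<Sum>J\<in>?B - {[]}. G J)"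
    unfolding sum_multi_indices_snoc by (rule sum_subtractf)
  also have "\<dots> = G []"
    by (simp add: sum.remove[OF finite_bounded_multi_indices Nil])
  finally show ?thesis by (simp add: G_def binom_moments_def A_def)
qed

text \<open>After expanding in Ys and inverting in Y, the Newton index k = 0 contributes every list
  with moments of Y only, while k \<ge> 1 contributes J @ [k] with its last moment taken from Ys and
  the opposite sign. Both contributions to a nonempty list merge into the difference of its last
  moments. The empty list occurs for k = 0 only and gives E g(U + Y).\<close>

lemma taylor_difference:
  assumes indep: "indep_var (count_space UNIV) Y (count_space UNIV) U"
    and indep_s: "indep_var (count_space UNIV) Ys (count_space UNIV) U"
    and int: "\<And>k. k \<le> m \<Longrightarrow> integrable M (\<lambda>\<omega>. (fdiff ^^ k) g (U \<omega> + Y \<omega>))"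
    and int_s: "integrable M (\<lambda>\<omega>. g (U \<omega> + Ys \<omega>))"
    and choose: "\<And>k. k \<le> m \<Longrightarrow> integrable M (\<lambda>\<omega>. real (Y \<omega> choose k))"
    and choose_s: "\<And>k. k \<le> m \<Longrightarrow> integrable M (\<lambda>\<omega>. real (Ys \<omega> choose k))"
    and int': "\<And>k. k \<le> m \<Longrightarrow> integrable M (\<lambda>\<omega>. (fdiff ^^ k) g (U \<omega>))"
  shows "(\<integral>\<omega>. g (U \<omega> + Ys \<omega>) \<partial>M) - (\<integral>\<omega>. g (U \<omega> + Y \<omega>) \<partial>M) =
     (\<Sum>J\<in>bounded_multi_indices m - {[]}. - ((-1) ^ length J) *
        (binom_moments M Y (butlast J) * (binom_moment M Ys (last J) - binom_moment M Y (last J)) *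
         (\<integral>\<omega>. (fdiff ^^ sum_list J) g (U \<omega> + Y \<omega>) \<partial>M)))
     + (\<Sum>k = 0..m. binom_moment M Ys k * taylor_eps M (m - k) ((fdiff ^^ k) g) U Y)
     + taylor_delta M m g U Ys"
proof -
  let ?B = "bounded_multi_indices"
  define A where "A k = (\<integral>\<omega>. (fdiff ^^ k) g (U \<omega> + Y \<omega>) \<partial>M)" for k
  define E where "E = (\<Sum>k = 0..m. binom_moment M Ys k * taylor_eps M (m - k) ((fdiff ^^ k) g) U Y)"
  define S where "S k = (\<Sum>J\<in>?B (m - k). (-1) ^ length J * (binom_moments M Y J * A (sum_list J + k)))" for k
  define H where "H J = - ((-1) ^ length J) *
    (binom_moments M Y (butlast J) * binom_moment M Ys (last J) * A (sum_list J))" for J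
  have Nil: "[] \<in> ?B m" by (simp add: bounded_multi_indices_def)
  have rev: "(\<integral>\<omega>. (fdiff ^^ k) g (U \<omega>) \<partial>M) = S k + taylor_eps M (m - k) ((fdiff ^^ k) g) U Y"
    if "k \<le> m" for k
  proof -
    have funpow: "(fdiff ^^ j) ((fdiff ^^ k) g) = (fdiff ^^ (j + k)) g" for j
      by (simp add: funpow_add)
    show ?thesis
      using that int choose int'
      by (subst reverse_taylor_expansion[OF indep, where m = "m - k"]) (auto simp: funpow S_def A_def)
  qed
  have "(\<integral>\<omega>. g (U \<omega> + Ys \<omega>) \<partial>M) =
      (\<Sum>k = 0..m. binom_moment M Ys k * (\<integral>\<omega>. (fdiff ^^ k) g (U \<omega>) \<partial>M)) + taylor_delta M m g U Ys"
    by (intro taylor_expansion_indep indep_s int_s choose_s int')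
  also have "\<dots> = (\<Sum>k = 0..m. binom_moment M Ys k * S k) + E + taylor_delta M m g U Ys"
    by (simp add: rev E_def distrib_left sum.distrib)
  also have "(\<Sum>k = 0..m. binom_moment M Ys k * S k) = S 0 + (\<Sum>k = 1..m. binom_moment M Ys k * S k)"
    by (simp add: sum.atLeast_Suc_atMost[of 0] binom_moment_def prob_space)
  \<comment> \<open>The sign in \<open>H\<close> is minus that of the extended list, which is the
    sign (-1)^(length J) of the list before k was appended.\<close>
  also have "(\<Sum>k = 1..m. binom_moment M Ys k * S k) = (\<Sum>J\<in>?B m - {[]}. H J)"
    unfolding sum_multi_indices_snoc' S_def H_def
    by (simp add: sum_distrib_left mult_ac add.commute)
  also have "S 0 = A 0 + (\<Sum>J\<in>?B m - {[]}. (-1) ^ length J * (binom_moments M Y J * A (sum_list J)))"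
    unfolding S_def
    by (simp add: sum.remove[OF finite_bounded_multi_indices Nil] binom_moments_def)
  also have "(\<Sum>J\<in>?B m - {[]}. (-1) ^ length J * (binom_moments M Y J * A (sum_list J))) =
      (\<Sum>J\<in>?B m - {[]}. (-1) ^ length J * (binom_moments M Y (butlast J) * binom_moment M Y (last J) *
        A (sum_list J)))"
  proof (rule sum.cong)
    fix J assume "J \<in> ?B m - {[]}"
    then obtain J' k where "J = J' @ [k]" by (cases J rule: rev_cases) auto
    then show "(-1) ^ length J * (binom_moments M Y J * A (sum_list J)) =
        (-1) ^ length J * (binom_moments M Y (butlast J) * binom_moment M Y (last J) * A (sum_list J))"
      by (simp add: binom_moments_def)
  qed simp
  finally have eq: "(\<integral>\<omega>. g (U \<omega> + Ys \<omega>) \<partial>M) - A 0 =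
      (\<Sum>J\<in>?B m - {[]}. (-1) ^ length J * (binom_moments M Y (butlast J) * binom_moment M Y (last J) *
        A (sum_list J))) + (\<Sum>J\<in>?B m - {[]}. H J) + E + taylor_delta M m g U Ys"
    by simp
  have A0: "A 0 = (\<integral>\<omega>. g (U \<omega> + Y \<omega>) \<partial>M)" by (simp add: A_def)
  show ?thesis
    unfolding eq[unfolded A0] sum.distrib[symmetric] E_def[symmetric] A_def[symmetric] H_def
    by (simp add: algebra_simps)
qed

section \<open>Integrability from moments and polynomial growth\<close>

lemma integrable_one_plus_powr:
  assumes X: "X \<in> measurable M (count_space UNIV)"
    and int: "integrable M (\<lambda>\<omega>. real (X \<omega>) powr Q)" and q: "0 \<le> q" "q \<le> Q"
  shows "integrable M (\<lambda>\<omega>. (1 + real (X \<omega>)) powr q)"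
proof (rule Bochner_Integration.integrable_bound)
  show "integrable M (\<lambda>\<omega>. 1 + 2 powr Q * real (X \<omega>) powr Q)"
    using int by simp
  \<comment> \<open>For x \<ge> 1 one has 1 + x \<le> 2 x, whence 2 powr Q; the summand 1 covers x =
    0.\<close>
  have "(1 + real x) powr q \<le> 1 + 2 powr Q * real x powr Q" for x :: nat
  proof (cases "x = 0")
    case False
    have "(1 + real x) powr q \<le> (1 + real x) powr Q"
      using q by (intro powr_mono) auto
    also have "\<dots> \<le> (2 * real x) powr Q"
      using q False by (intro powr_mono2) auto
    finally show ?thesis by (simp add: powr_mult)
  qed simp
  then show "AE \<omega> in M. norm ((1 + real (X \<omega>)) powr q) \<le> norm (1 + 2 powr Q * real (X \<omega>) powr Q)"
    by (intro AE_I2) (simp add: order_trans[OF _ abs_ge_self])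
qed (rule borel_measurable_nat_rv[OF X])

lemma integrable_poly_growth:
  assumes U: "U \<in> measurable M (count_space UNIV)" and F: "poly_growth q F"
    and int: "integrable M (\<lambda>\<omega>. (1 + real (U \<omega>)) powr q)"
  shows "integrable M (\<lambda>\<omega>. F (U \<omega>))"
proof -
  obtain C where C: "0 \<le> C" "\<And>x. \<bar>F x\<bar> \<le> C * (1 + real x) powr q"
    using poly_growthD[OF F] by blast
  show ?thesis
    using C by (intro Bochner_Integration.integrable_bound[OF integrable_mult_right[OF int, of C]]
      borel_measurable_nat_rv[OF U]) (auto simp: abs_mult)
qed

end

section \<open>Sums of independent variables\<close>

text \<open>The factor x in Stein's equation and in the zero-bias identity raises the exponent by
  one; this is the + 1 in the moment condition.\<close>

lemma poly_growth_mult_self: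
  assumes "poly_growth p f"
  shows "poly_growth (p + 1) (\<lambda>x. real x * f x)"
proof -
  obtain C where C: "0 \<le> C" "\<And>x. \<bar>f x\<bar> \<le> C * (1 + real x) powr p"
    using poly_growthD[OF assms] by blast
  have "\<bar>real x * f x\<bar> \<le> C * (1 + real x) powr (p + 1)" for x
  proof -
    have "\<bar>real x * f x\<bar> \<le> (1 + real x) * (C * (1 + real x) powr p)"
      unfolding abs_mult by (intro mult_mono C) auto
    then show ?thesis by (simp add: powr_add mult_ac)
  qed
  then show ?thesis unfolding poly_growth_def by blast
qed

text \<open>Zero bias speaks of f(Xs + 1), so a statement on F at Xs comes from the test function
  F(x - 1). Its truncated value at x = 0 meets the weight x = 0.\<close>

lemma poly_growth_pred:
  assumes "poly_growth p f" "0 \<le> p"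
  shows "poly_growth p (\<lambda>x. f (x - 1))"
proof -
  obtain C where C: "0 \<le> C" "\<And>x. \<bar>f x\<bar> \<le> C * (1 + real x) powr p"
    using poly_growthD[OF assms(1)] by blast
  have "\<bar>f (x - 1)\<bar> \<le> C * (1 + real x) powr p" for x
  proof -
    have "(1 + real (x - 1)) powr p \<le> (1 + real x) powr p"
      using assms(2) by (intro powr_mono2) auto
    then show ?thesis
      using C(2)[of "x - 1"] mult_left_mono[OF _ C(1)] order_trans by blast
  qed
  then show ?thesis unfolding poly_growth_def by blast
qed

lemma poly_growth_choose: "poly_growth (real k) (\<lambda>x. real (x choose k))"
proof -
  have "\<bar>real (x choose k)\<bar> \<le> 1 * (1 + real x) powr real k" for x
  proof (cases "k \<le> x")
    case True
    then have "real (x choose k) \<le> real x ^ k"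
      using binomial_le_pow[OF True] by (metis of_nat_le_iff of_nat_power)
    also have "\<dots> \<le> (1 + real x) ^ k" by (intro power_mono) auto
    finally show ?thesis by (simp add: powr_realpow)
  qed (simp add: not_le binomial_eq_0)
  then show ?thesis unfolding poly_growth_def by blast
qed

text \<open>The function h is left out because the induction ranges over all functions of growth p,
  whereas N and p stay fixed as the moment budget.\<close>

locale independent_summands = prob_space +
  fixes X Xs :: "nat \<Rightarrow> 'a \<Rightarrow> nat" and n N :: nat and p :: real
  assumes n: "1 \<le> n" and p: "0 \<le> p"
    and indep: "indep_vars (\<lambda>_. count_space UNIV) X {1..n}"
    and moments: "\<And>i. i \<in> {1..n} \<Longrightarrow> integrable M (\<lambda>\<omega>. real (X i \<omega>) powr (real N + p + 1))"
    and pos: "\<And>i. i \<in> {1..n} \<Longrightarrow> 0 < mean M (X i)"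
    and indep_s: "\<And>i. i \<in> {1..n} \<Longrightarrow>
      indep_var (count_space UNIV) (Xs i) (count_space UNIV) (rv_sum_without n X i)"
    and biased: "\<And>i. i \<in> {1..n} \<Longrightarrow> poisson_zero_biased M (X i) (Xs i)"
begin

abbreviation W where "W \<equiv> rv_sum n X"
abbreviation W' where "W' \<equiv> rv_sum_without n X"
abbreviation l where "l \<equiv> mean M W"

lemma X_measurable: "i \<in> {1..n} \<Longrightarrow> X i \<in> measurable M (count_space UNIV)"
  using indep by (simp add: indep_vars_def)

lemma Xs_measurable: "i \<in> {1..n} \<Longrightarrow> Xs i \<in> measurable M (count_space UNIV)"
  using indep_var_rv1[OF indep_s] .

lemma W'_measurable: "i \<in> {1..n} \<Longrightarrow> W' i \<in> measurable M (count_space UNIV)"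
  using indep_var_rv2[OF indep_s] .

lemma W'_eq: "i \<in> {1..n} \<Longrightarrow> W' i \<omega> = (\<Sum>j\<in>{1..n} - {i}. X j \<omega>)"
  using sum.remove[of "{1..n}" i "\<lambda>j. X j \<omega>"] by (simp add: rv_sum_without_def rv_sum_def)

lemma W_eq: "i \<in> {1..n} \<Longrightarrow> W \<omega> = W' i \<omega> + X i \<omega>"
  using sum.remove[of "{1..n}" i "\<lambda>j. X j \<omega>"] by (simp add: W'_eq rv_sum_def)

lemma W_measurable: "W \<in> measurable M (count_space UNIV)"
proof -
  have "(\<lambda>\<omega>. \<Sum>i = 1..n. X i \<omega>) \<in> borel_measurable M"
    using X_measurable by (intro borel_measurable_sum) (simp add: measurable_def sets_borel_eq_count_space)
  then show ?thesis
    by (simp add: rv_sum_def[abs_def] cong: measurable_cong_sets[OF refl sets_borel_eq_count_space])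
qed

text \<open>Both variables are functions of restrictions of the family to disjoint index blocks, {i}
  and its complement in {1..n}.\<close>

lemma indep_X_W':
  assumes i: "i \<in> {1..n}"
  shows "indep_var (count_space UNIV) (X i) (count_space UNIV) (W' i)"
proof -
  let ?C = "\<lambda>_. count_space UNIV :: nat measure"
  have "(\<lambda>f. \<Sum>j\<in>{1..n} - {i}. f j) \<in> measurable (PiM ({1..n} - {i}) ?C) (borel :: nat measure)"
    by (intro borel_measurable_sum)
       (simp cong: measurable_cong_sets[OF refl sets_borel_eq_count_space])
  then have sum: "(\<lambda>f. \<Sum>j\<in>{1..n} - {i}. f j) \<in> measurable (PiM ({1..n} - {i}) ?C) (count_space UNIV :: nat measure)"
    by (simp cong: measurable_cong_sets[OF refl sets_borel_eq_count_space])
  have "indep_var (count_space UNIV) ((\<lambda>f. f i) \<circ> (\<lambda>\<omega>. restrict (\<lambda>i. X i \<omega>) {i}))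
      (count_space UNIV) ((\<lambda>f. \<Sum>j\<in>{1..n} - {i}. f j) \<circ> (\<lambda>\<omega>. restrict (\<lambda>i. X i \<omega>) ({1..n} - {i})))"
    using i by (intro indep_var_compose[OF indep_var_restrict[OF indep]] sum) auto
  also have "((\<lambda>f. f i) \<circ> (\<lambda>\<omega>. restrict (\<lambda>i. X i \<omega>) {i})) = X i"
    by auto
  also have "((\<lambda>f. \<Sum>j\<in>{1..n} - {i}. f j) \<circ> (\<lambda>\<omega>. restrict (\<lambda>i. X i \<omega>) ({1..n} - {i}))) = W' i"
    using i by (auto simp: fun_eq_iff W'_eq)
  finally show ?thesis .
qed

lemma X_moment:
  assumes "i \<in> {1..n}" "0 \<le> q" "q \<le> real N + p + 1"
  shows "integrable M (\<lambda>\<omega>. (1 + real (X i \<omega>)) powr q)"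
  using assms by (intro integrable_one_plus_powr[OF X_measurable moments])

text \<open>Since 1 + W is at most the product of the 1 + X_i, and products of independent
  integrable variables are integrable, W has the same moments as its summands, without loss of
  order.\<close>

lemma W_moment:
  assumes q: "0 \<le> q" "q \<le> real N + p + 1"
  shows "integrable M (\<lambda>\<omega>. (1 + real (W \<omega>)) powr q)"
proof (rule Bochner_Integration.integrable_bound)
  have "indep_vars (\<lambda>_. borel) (\<lambda>i \<omega>. (1 + real (X i \<omega>)) powr q) {1..n}"
    by (rule indep_vars_compose2[OF indep, where Y = "\<lambda>_ x. (1 + real x) powr q"]) auto
  then show "integrable M (\<lambda>\<omega>. \<Prod>i = 1..n. (1 + real (X i \<omega>)) powr q)"
    using q by (intro indep_vars_integrable X_moment) auto
  have "(1 + real (\<Sum>i\<in>A. X i \<omega>)) powr q \<le> (\<Prod>i\<in>A. (1 + real (X i \<omega>)) powr q)"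
    if "finite A" for A \<omega>
    using that
  proof induction
    case (insert i A)
    have "(1 + real (\<Sum>j\<in>insert i A. X j \<omega>)) powr q \<le>
        (1 + real (X i \<omega>)) powr q * (1 + real (\<Sum>j\<in>A. X j \<omega>)) powr q"
      using one_plus_powr_add_le[OF q(1), of "X i \<omega>" "\<Sum>j\<in>A. X j \<omega>"] insert by simp
    also have "\<dots> \<le> (1 + real (X i \<omega>)) powr q * (\<Prod>j\<in>A. (1 + real (X j \<omega>)) powr q)"
      by (intro mult_left_mono insert) simp
    finally show ?case using insert by simp
  qed simp
  from this[of "{1..n}"]
  show "AE \<omega> in M. norm ((1 + real (W \<omega>)) powr q) \<le> norm (\<Prod>i = 1..n. (1 + real (X i \<omega>)) powr q)"
    by (intro AE_I2) (auto simp: rv_sum_def abs_prod)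
qed (rule borel_measurable_nat_rv[OF W_measurable])

lemma W'_moment:
  assumes i: "i \<in> {1..n}" and q: "0 \<le> q" "q \<le> real N + p + 1"
  shows "integrable M (\<lambda>\<omega>. (1 + real (W' i \<omega>)) powr q)"
  by (rule Bochner_Integration.integrable_bound[OF W_moment[OF q]])
     (auto simp: W_eq[OF i] q intro!: powr_mono2 borel_measurable_nat_rv[OF W'_measurable[OF i]])

lemma integrable_W:
  assumes "poly_growth q F" "0 \<le> q" "q \<le> real N + p + 1"
  shows "integrable M (\<lambda>\<omega>. F (W \<omega>))"
  using assms by (intro integrable_poly_growth[OF W_measurable _ W_moment])

lemma integrable_W':
  assumes "i \<in> {1..n}" "poly_growth q F" "0 \<le> q" "q \<le> real N + p + 1"
  shows "integrable M (\<lambda>\<omega>. F (W' i \<omega>))"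
  using assms by (intro integrable_poly_growth[OF W'_measurable _ W'_moment])

lemma integrable_X:
  assumes "i \<in> {1..n}" "poly_growth q F" "0 \<le> q" "q \<le> real N + p + 1"
  shows "integrable M (\<lambda>\<omega>. F (X i \<omega>))"
  using assms by (intro integrable_poly_growth[OF X_measurable _ X_moment])

lemma integrable_X_mult:
  assumes "i \<in> {1..n}" "poly_growth q F" "0 \<le> q" "q \<le> real N + p"
  shows "integrable M (\<lambda>\<omega>. real (X i \<omega>) * F (X i \<omega>))"
  using assms(3,4) by (intro integrable_X[OF assms(1) poly_growth_mult_self[OF assms(2)]]) auto

text \<open>Order q for Xs comes from order q + 1 for X, hence the limit N + p in place of N + p +
  1.\<close>

lemma integrable_Xs:
  assumes i: "i \<in> {1..n}" and F: "poly_growth q F" "0 \<le> q" "q \<le> real N + p"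
  shows "integrable M (\<lambda>\<omega>. F (Xs i \<omega>))"
  using zero_biased_integrable[OF biased[OF i] pos[OF i] X_measurable[OF i] Xs_measurable[OF i],
      of "\<lambda>x. F (x - 1)"] integrable_X_mult[OF i poly_growth_pred[OF F(1,2)] F(2,3)]
  by simp

lemma Xs_expectation:
  assumes i: "i \<in> {1..n}" and F: "poly_growth q F" "0 \<le> q" "q \<le> real N + p"
  shows "mean M (X i) * (\<integral>\<omega>. F (Xs i \<omega>) \<partial>M) = (\<integral>\<omega>. real (X i \<omega>) * F (X i \<omega> - 1) \<partial>M)"
  using poisson_zero_biased_def[THEN iffD1, rule_format,
      OF biased[OF i] integrable_X_mult[OF i poly_growth_pred[OF F(1,2)] F(2,3)]]
  by simp

lemma integrable_W'_Xs:
  assumes i: "i \<in> {1..n}" and g: "poly_growth p g"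
  shows "integrable M (\<lambda>\<omega>. g (W' i \<omega> + Xs i \<omega>))"
proof -
  obtain C where C: "0 \<le> C" "\<And>x. \<bar>g x\<bar> \<le> C * (1 + real x) powr p"
    using poly_growthD[OF g] by blast
  have self: "poly_growth p (\<lambda>x. (1 + real x) powr p)"
    unfolding poly_growth_def by (rule exI[of _ 1]) simp
  show ?thesis
  proof (rule Bochner_Integration.integrable_bound)
    show "integrable M (\<lambda>\<omega>. C * ((1 + real (Xs i \<omega>)) powr p * (1 + real (W' i \<omega>)) powr p))"
      using p by (intro integrable_mult_right indep_nat_mult(1)[OF indep_s[OF i]]
        integrable_Xs[OF i self] W'_moment i) auto
    show "AE \<omega> in M. norm (g (W' i \<omega> + Xs i \<omega>)) \<le>
        norm (C * ((1 + real (Xs i \<omega>)) powr p * (1 + real (W' i \<omega>)) powr p))"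
    proof (rule AE_I2)
      fix \<omega>
      show "norm (g (W' i \<omega> + Xs i \<omega>)) \<le>
        norm (C * ((1 + real (Xs i \<omega>)) powr p * (1 + real (W' i \<omega>)) powr p))"
        using order_trans[OF C(2) mult_left_mono[OF one_plus_powr_add_le[OF p] C(1)],
            of "W' i \<omega>" "Xs i \<omega>"] C(1)
        by (simp add: abs_mult mult_ac)
    qed
  qed (rule borel_measurable_nat_rv2[OF W'_measurable[OF i] Xs_measurable[OF i]])
qed

text \<open>The zero-bias identity concerns X_i alone. With W_i frozen at w, the function g(w + x)
  is a test function in x of the same growth; independence of W_i from X_i and from Xs i allows
  averaging over w on either side.\<close>

lemma zero_bias_W:
  assumes i: "i \<in> {1..n}" and g: "poly_growth p g"
  shows "integrable M (\<lambda>\<omega>. real (X i \<omega>) * g (W \<omega> - 1))"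
    and "mean M (X i) * (\<integral>\<omega>. g (W' i \<omega> + Xs i \<omega>) \<partial>M) = (\<integral>\<omega>. real (X i \<omega>) * g (W \<omega> - 1) \<partial>M)"
proof -
  let ?F = "\<lambda>w x. real x * g (w + (x - 1))"
  \<comment> \<open>For X_i = 0, W - 1 need not equal W_i + (X_i - 1) in truncated subtraction, but
    the factor X_i makes both sides 0.\<close>
  have F: "?F (W' i \<omega>) (X i \<omega>) = real (X i \<omega>) * g (W \<omega> - 1)" for \<omega>
    by (cases "X i \<omega>") (auto simp: W_eq[OF i])
  show int: "integrable M (\<lambda>\<omega>. real (X i \<omega>) * g (W \<omega> - 1))"
  proof (rule Bochner_Integration.integrable_bound)
    \<comment> \<open>As X_i \<le> W, a function of W of growth p + 1 dominates, and W has moments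
      of that order.\<close>
    show "integrable M (\<lambda>\<omega>. real (W \<omega>) * g (W \<omega> - 1))"
      using integrable_W[OF poly_growth_mult_self[OF poly_growth_pred[OF g p]]] p by simp
    show "AE \<omega> in M. norm (real (X i \<omega>) * g (W \<omega> - 1)) \<le> norm (real (W \<omega>) * g (W \<omega> - 1))"
      by (auto simp: abs_mult W_eq[OF i] intro!: mult_right_mono)
  qed (rule borel_measurable_nat_rv2[OF X_measurable[OF i] W_measurable, of "\<lambda>x w. real x * g (w - 1)"])
  have "(\<integral>\<omega>. real (X i \<omega>) * g (W \<omega> - 1) \<partial>M) =
      (\<integral>\<omega>. (\<integral>\<omega>'. ?F (W' i \<omega>) (X i \<omega>') \<partial>M) \<partial>M)"
    using indep_nat_expectation_iterated[OF indep_var_nat_commute[OF indep_X_W'[OF i]], of ?F,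
        unfolded F, OF int] .
  also have "\<dots> = (\<integral>\<omega>. mean M (X i) * (\<integral>\<omega>'. g (W' i \<omega> + Xs i \<omega>') \<partial>M) \<partial>M)"
  proof (intro Bochner_Integration.integral_cong refl)
    fix \<omega>
    have "poly_growth p (\<lambda>x. g (W' i \<omega> + x))"
      using poly_growth_shift[OF g p, of "W' i \<omega>"] by (simp add: add.commute)
    from Xs_expectation[OF i this] p
    show "(\<integral>\<omega>'. ?F (W' i \<omega>) (X i \<omega>') \<partial>M) = mean M (X i) * (\<integral>\<omega>'. g (W' i \<omega> + Xs i \<omega>') \<partial>M)"
      by simp
  qed
  also have "\<dots> = mean M (X i) * (\<integral>\<omega>. g (W' i \<omega> + Xs i \<omega>) \<partial>M)"
    using indep_nat_expectation_iterated[OF indep_var_nat_commute[OF indep_s[OF i]], of "\<lambda>w x. g (w + x)"]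
      integrable_W'_Xs[OF i g] by simp
  finally show "mean M (X i) * (\<integral>\<omega>. g (W' i \<omega> + Xs i \<omega>) \<partial>M) = (\<integral>\<omega>. real (X i \<omega>) * g (W \<omega> - 1) \<partial>M)"
    by simp
qed

section \<open>Stein's identity for the sum and induction on the order\<close>

lemma mean_W: "l = (\<Sum>i = 1..n. mean M (X i))"
proof -
  have "poly_growth 1 (\<lambda>x. real x * 1)"
    using poly_growth_mult_self[OF poly_growth_const[of 0 1]] by simp
  then have "integrable M (\<lambda>\<omega>. real (X i \<omega>))" if "i \<in> {1..n}" for i
    using integrable_X[OF that, of 1 real] p by simp
  then show ?thesis
    by (simp add: mean_def rv_sum_def Bochner_Integration.integral_sum)
qed

lemma mean_W_pos: "0 < l"
  unfolding mean_W using n pos by (intro sum_pos) auto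

text \<open>In Stein's equation at W, the factor W splits into the X_i and the parameter
  \<open>l\<close> into their means. Both terms thereby become sums over i with the common weight
  \<open>mean M (X i)\<close>.\<close>

lemma stein_expectation:
  assumes h: "poly_growth p h"
  shows "(\<integral>\<omega>. h (W \<omega>) \<partial>M) = poisson_mean l h + (\<Sum>i = 1..n. mean M (X i) *
    ((\<integral>\<omega>. stein_sol_shift l h (W' i \<omega> + Xs i \<omega>) \<partial>M) - (\<integral>\<omega>. stein_sol_shift l h (W' i \<omega> + X i \<omega>) \<partial>M)))"
proof -
  let ?g = "stein_sol_shift l h"
  have g: "poly_growth p ?g"
    by (rule poly_growth_stein_sol_shift[OF mean_W_pos p h])
  have eq: "h x = poisson_mean l h + (real x * ?g (x - 1) - l * ?g x)" for x
    using stein_equation[OF mean_W_pos p h, of x] by (cases x) (auto simp: stein_sol_shift_def)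
  have int1: "integrable M (\<lambda>\<omega>. real (W \<omega>) * ?g (W \<omega> - 1))"
    using integrable_W[OF poly_growth_mult_self[OF poly_growth_pred[OF g p]]] p by simp
  have int2: "integrable M (\<lambda>\<omega>. ?g (W \<omega>))"
    using integrable_W[OF g] p by simp
  have "(\<integral>\<omega>. h (W \<omega>) \<partial>M) =
      (\<integral>\<omega>. poisson_mean l h + (real (W \<omega>) * ?g (W \<omega> - 1) - l * ?g (W \<omega>)) \<partial>M)"
    by (rule Bochner_Integration.integral_cong[OF refl eq])
  also have "\<dots> = poisson_mean l h + ((\<integral>\<omega>. real (W \<omega>) * ?g (W \<omega> - 1) \<partial>M) - l * (\<integral>\<omega>. ?g (W \<omega>) \<partial>M))"
    using int1 int2 by (simp add: prob_space)
  also have "(\<integral>\<omega>. real (W \<omega>) * ?g (W \<omega> - 1) \<partial>M) =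
      (\<Sum>i = 1..n. \<integral>\<omega>. real (X i \<omega>) * ?g (W \<omega> - 1) \<partial>M)"
    using zero_bias_W(1)[OF _ g]
    by (subst Bochner_Integration.integral_sum[symmetric])
       (auto simp: rv_sum_def sum_distrib_right)
  also have "\<dots> = (\<Sum>i = 1..n. mean M (X i) * (\<integral>\<omega>. ?g (W' i \<omega> + Xs i \<omega>) \<partial>M))"
    using zero_bias_W(2)[OF _ g] by (intro sum.cong) auto
  also have "l * (\<integral>\<omega>. ?g (W \<omega>) \<partial>M) = (\<Sum>i = 1..n. mean M (X i) * (\<integral>\<omega>. ?g (W' i \<omega> + X i \<omega>) \<partial>M))"
    \<comment> \<open>The rule rewrites \<open>l\<close> only as a left factor;
      \<open>mean_W\<close> itself would also rewrite the parameter of the Stein solution.\<close>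
    unfolding sum_distrib_right mean_W[THEN arg_cong[of _ _ "\<lambda>x. x * _"]]
    by (intro sum.cong refl arg_cong2[where f = "(*)"] Bochner_Integration.integral_cong)
       (auto simp: W_eq)
  finally show ?thesis by (simp add: right_diff_distrib sum_subtractf)
qed

text \<open>\<open>C_term\<close> and \<open>e_term\<close> have the same coefficients in front of
  their lower-order values, so these values recombine to expectations at W. The claim is proved for
  all h of growth p at once, since order m for h calls on lower orders for differences of its Stein
  solution.\<close>

lemma expansion:
  assumes "m \<le> N" "poly_growth p h"
  shows "(\<integral>\<omega>. h (W \<omega>) \<partial>M) = C_term M n X Xs m h + e_term M n X Xs m h"
  using assms
proof (induction m arbitrary: h rule: less_induct)
  case (less m)
  show ?case
  proof (cases m)
    case 0
    then show ?thesis by simp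
  next
    case (Suc m')
    let ?g = "stein_sol_shift l h"
    have g: "poly_growth p ((fdiff ^^ k) ?g)" for k
      by (intro poly_growth_fdiff_funpow poly_growth_stein_sol_shift mean_W_pos p less.prems)
    have diff: "(\<integral>\<omega>. ?g (W' i \<omega> + Xs i \<omega>) \<partial>M) - (\<integral>\<omega>. ?g (W' i \<omega> + X i \<omega>) \<partial>M) =
       (\<Sum>J\<in>bounded_multi_indices m - {[]}. - ((-1) ^ length J) *
          (binom_moments M (X i) (butlast J) * (binom_moment M (Xs i) (last J) - binom_moment M (X i) (last J)) *
            C_term M n X Xs (m - sum_list J) ((fdiff ^^ sum_list J) ?g)))
       + (\<Sum>J\<in>bounded_multi_indices m - {[]}. - ((-1) ^ length J) *
          (binom_moments M (X i) (butlast J) * (binom_moment M (Xs i) (last J) - binom_moment M (X i) (last J)) *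
            e_term M n X Xs (m - sum_list J) ((fdiff ^^ sum_list J) ?g)))
       + (\<Sum>k = 0..m. binom_moment M (Xs i) k * taylor_eps M (m - k) ((fdiff ^^ k) ?g) (W' i) (X i))
       + taylor_delta M m ?g (W' i) (Xs i)"
      (is "?L = _") if i: "i \<in> {1..n}" for i
    proof -
      have int: "integrable M (\<lambda>\<omega>. (fdiff ^^ k) ?g (W' i \<omega> + X i \<omega>))" for k
        using integrable_W[OF g, of k] p by (simp add: W_eq[OF i])
      have choose: "integrable M (\<lambda>\<omega>. real (X i \<omega> choose k))"
        "integrable M (\<lambda>\<omega>. real (Xs i \<omega> choose k))" if "k \<le> m" for k
        using that less.prems p
        by (auto intro!: integrable_X[OF i poly_growth_choose] integrable_Xs[OF i poly_growth_choose])
      have IH: "(\<integral>\<omega>. (fdiff ^^ sum_list J) ?g (W' i \<omega> + X i \<omega>) \<partial>M) =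
          C_term M n X Xs (m - sum_list J) ((fdiff ^^ sum_list J) ?g) +
          e_term M n X Xs (m - sum_list J) ((fdiff ^^ sum_list J) ?g)"
        if "J \<in> bounded_multi_indices m - {[]}" for J
      proof -
        \<comment> \<open>A nonempty list of positive entries has positive sum, so the order m - |J|
          is strictly smaller than m.\<close>
        have "0 < sum_list J"
          using that by (cases J) (auto simp: bounded_multi_indices_def)
        then show ?thesis
          using less.IH[of "m - sum_list J", OF _ _ g[of "sum_list J"]] less.prems Suc
          by (simp add: W_eq[OF i])
      qed
      have "?L = (\<Sum>J\<in>bounded_multi_indices m - {[]}. - ((-1) ^ length J) *
          (binom_moments M (X i) (butlast J) * (binom_moment M (Xs i) (last J) - binom_moment M (X i) (last J)) *
           (\<integral>\<omega>. (fdiff ^^ sum_list J) ?g (W' i \<omega> + X i \<omega>) \<partial>M)))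
       + (\<Sum>k = 0..m. binom_moment M (Xs i) k * taylor_eps M (m - k) ((fdiff ^^ k) ?g) (W' i) (X i))
       + taylor_delta M m ?g (W' i) (Xs i)"
        using p by (intro taylor_difference indep_X_W' indep_s int integrable_W'_Xs choose
          integrable_W'[OF i g] i g[of 0, simplified]) auto
      also have "(\<Sum>J\<in>bounded_multi_indices m - {[]}. - ((-1) ^ length J) *
          (binom_moments M (X i) (butlast J) * (binom_moment M (Xs i) (last J) - binom_moment M (X i) (last J)) *
           (\<integral>\<omega>. (fdiff ^^ sum_list J) ?g (W' i \<omega> + X i \<omega>) \<partial>M))) =
         (\<Sum>J\<in>bounded_multi_indices m - {[]}. - ((-1) ^ length J) *
          (binom_moments M (X i) (butlast J) * (binom_moment M (Xs i) (last J) - binom_moment M (X i) (last J)) *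
            C_term M n X Xs (m - sum_list J) ((fdiff ^^ sum_list J) ?g)))
       + (\<Sum>J\<in>bounded_multi_indices m - {[]}. - ((-1) ^ length J) *
          (binom_moments M (X i) (butlast J) * (binom_moment M (Xs i) (last J) - binom_moment M (X i) (last J)) *
            e_term M n X Xs (m - sum_list J) ((fdiff ^^ sum_list J) ?g)))"
        unfolding sum.distrib[symmetric] by (intro sum.cong refl) (simp add: IH distrib_left)
      finally show ?thesis .
    qed
    have "(\<integral>\<omega>. h (W \<omega>) \<partial>M) = poisson_mean l h + (\<Sum>i = 1..n. mean M (X i) *
        ((\<integral>\<omega>. ?g (W' i \<omega> + Xs i \<omega>) \<partial>M) - (\<integral>\<omega>. ?g (W' i \<omega> + X i \<omega>) \<partial>M)))"
      by (rule stein_expectation) fact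
    also have "\<dots> = C_term M n X Xs m h + e_term M n X Xs m h"
      \<comment> \<open>The form Suc m' makes the recursive equations applicable. Afterwards
        everything except \<open>poisson_mean\<close> sits under a single sum over i, where
        \<open>diff\<close> gives equality of the summands.\<close>
      unfolding Suc C_term.simps e_term.simps sum_multi_indices_nonempty add.assoc sum.distrib[symmetric]
        distrib_left[symmetric]
      by (intro arg_cong2[where f = "(+)"] sum.cong refl arg_cong2[where f = "(*)"])
         (simp add: diff[unfolded Suc])
    finally show ?thesis .
  qed
qed

end

theorem theorem1p2:
  fixes M :: "'a measure" and X Xs :: "nat \<Rightarrow> 'a \<Rightarrow> nat"
    and n N :: nat and p :: real and h :: "nat \<Rightarrow> real"
  assumes "prob_space M"
    and "1 \<le> n"
    and "0 \<le> p"
    and "h \<in> O(\<lambda>x. real x powr p)"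
    and "prob_space.indep_vars M (\<lambda>_. count_space UNIV) X {1..n}"
    and "\<And>i. i \<in> {1..n} \<Longrightarrow> integrable M (\<lambda>\<omega>. real (X i \<omega>) powr (real N + p + 1))"
    and "\<And>i. i \<in> {1..n} \<Longrightarrow> 0 < mean M (X i)"
    and "\<And>i. i \<in> {1..n} \<Longrightarrow>
           prob_space.indep_var M (count_space UNIV) (Xs i) (count_space UNIV) (rv_sum_without n X i)"
    and "\<And>i. i \<in> {1..n} \<Longrightarrow> poisson_zero_biased M (X i) (Xs i)"
  shows "(\<integral>\<omega>. h (rv_sum n X \<omega>) \<partial>M) = C_term M n X Xs N h + e_term M n X Xs N h"
proof -
  interpret independent_summands M X Xs n N p
    using assms unfolding independent_summands_def independent_summands_axioms_def by blast
  show ?thesis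
    by (rule expansion[OF order_refl poly_growth_bigo[OF assms(4,3)]])
qed

end
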